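(* Let $k\ge5$ be odd. If $k\equiv 1\pmod 4$ and $n\ge \max\{k+4,\frac{7k+1}{4}\}$, then $d_{3,n,k}=14$. If $k\equiv 3\pmod 4$ and $n\ge k+4$, then $d_{3,n,k}=16$.
   Context: Let $N$ be an $n$-element set of points. A binary $t$-$(n,k)$-design is a nonempty set $D$ of $k$-element subsets of $N$ (blocks; no repeated blocks) such that every $t$-element subset of $N$ is contained in an even number of blocks of $D$. $d_{t,n,k}$ denotes the minimum number of blocks of a binary $t$-$(n,k)$-design, equivalently the minimum distance of the binary linear code whose parity-check matrix is the inclusion matrix of $t$-subsets versus $k$-subsets of an $n$-set. *)

theory Defs
  imports Complex_Main
begin

definition binary_design :: "nat \<Rightarrow> 'a set \<Rightarrow> nat \<Rightarrow> 'a set set \<Rightarrow> bool" where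
  "binary_design t N k D \<longleftrightarrow>
     D \<noteq> {} \<and>
     (\<forall>B\<in>D. B \<subseteq> N \<and> card B = k) \<and>
     (\<forall>T. T \<subseteq> N \<and> card T = t \<longrightarrow> even (card {B \<in> D. T \<subseteq> B}))"

(* The n-element point set is fixed to be {..<n}; the minimum does not depend on this choice.
   If no binary t-(n,k)-design exists, the value is Inf {} = 0, which cannot be the number
   of blocks of a design, since designs are nonempty. *)
definition min_blocks :: "nat \<Rightarrow> nat \<Rightarrow> nat \<Rightarrow> nat" where
  "min_blocks t n k = Inf {card D | D. binary_design t {..<n} k D}"

end

theory Submission
  imports Defs
begin

text \<open>
  A nonempty family in which every set of at most \<open>t\<close> points lies in an even number of blocks has
  at least \<open>2^(t+1)\<close> members, by splitting it at a point that separates two blocks. Double counting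
  shows that for odd \<open>k\<close> all pairs have even degree in a design, and for \<open>k \<equiv> 3 (mod 4)\<close> all
  points as well, which gives the bound 16.

  For \<open>k \<equiv> 1 (mod 4)\<close>, let \<open>S\<close> be the set of points of odd degree; the \<open>m\<close> blocks and the
  singletons of \<open>S\<close> together form such a family for \<open>t = 3\<close>. If it has exactly 16 members, it is
  closed under translation by differences of its singletons, so that \<open>|S| \<le> 2\<close>. Otherwise
  \<open>m + |S| \<ge> 18\<close>. If then \<open>m \<le> 13\<close>, at most 6 blocks avoid a given point \<open>x \<in> S\<close>, and linear
  algebra over the field with two elements forces them to be all 5-subsets of the 6-set \<open>S - {x}\<close>.
  Letting \<open>x\<close> vary yields 21 blocks, a contradiction.
\<close>

section \<open>Set families with even degrees\<close>

definition deg :: "'a set set \<Rightarrow> 'a set \<Rightarrow> nat" where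
  "deg G T = card {B \<in> G. T \<subseteq> B}"

text \<open>For subsets of an n-set these are the words of the Reed-Muller code of order n - t - 1.
  \<open>T\<close> ranges over all finite sets, so no ground set has to be carried along.\<close>

definition even_upto :: "nat \<Rightarrow> 'a set set \<Rightarrow> bool" where
  "even_upto t G \<longleftrightarrow> finite G \<and> (\<forall>T. finite T \<and> card T \<le> t \<longrightarrow> even (deg G T))"

lemma even_uptoD: "even_upto t G \<Longrightarrow> finite T \<Longrightarrow> card T \<le> t \<Longrightarrow> even (deg G T)"
  by (simp add: even_upto_def)

lemma deg_empty [simp]: "deg G {} = card G"
  by (simp add: deg_def)

lemma deg_filter: "deg {B \<in> G. x \<in> B} T = deg G (insert x T)"
  unfolding deg_def by (rule arg_cong[where f=card]) auto

lemma deg_split: "finite G \<Longrightarrow> deg G T = deg G (insert x T) + deg {B \<in> G. x \<notin> B} T"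
  unfolding deg_def
  by (subst card_Un_disjoint[symmetric]) (auto intro!: arg_cong[where f=card])

lemma even_upto_filter:
  assumes "even_upto (Suc t) G"
  shows "even_upto t {B \<in> G. x \<in> B}" "even_upto t {B \<in> G. x \<notin> B}"
proof -
  have ins: "even (deg G (insert x T))" if "finite T" "card T \<le> t" for T
    using that by (intro even_uptoD[OF assms]) (auto simp: card_insert_if)
  have fin: "finite G" using assms by (simp add: even_upto_def)
  show "even_upto t {B \<in> G. x \<in> B}"
    using ins fin by (simp add: even_upto_def deg_filter)
  have "even (deg {B \<in> G. x \<notin> B} T)" if "finite T" "card T \<le> t" for T
    using ins[OF that] deg_split[OF fin, of T x] even_uptoD[OF assms, of T] that by simp
  then show "even_upto t {B \<in> G. x \<notin> B}"
    using fin by (simp add: even_upto_def)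
qed

lemma even_upto_card_ge:
  assumes "even_upto t G" "G \<noteq> {}"
  shows "2 ^ Suc t \<le> card G"
  using assms
proof (induction t arbitrary: G)
  case 0
  then have "even (card G)" "card G > 0"
    using even_uptoD[of 0 G "{}"] by (auto simp: even_upto_def card_gt_0_iff)
  then show ?case using dvd_imp_le by fastforce
next
  case (Suc t)
  have fin: "finite G" and "even (card G)"
    using Suc.prems even_uptoD[of "Suc t" G "{}"] by (auto simp: even_upto_def)
  \<comment> \<open>Even size rules out a single block, so two distinct blocks exist and some point
    lies in only one of them.\<close>
  then have "card G \<noteq> 1" by auto
  obtain B where "B \<in> G" using Suc.prems by auto
  moreover obtain C where "C \<in> G" "C \<noteq> B"
    using \<open>card G \<noteq> 1\<close> \<open>B \<in> G\<close> by (metis is_singletonI' is_singleton_altdef empty_iff)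
  ultimately obtain x where "{B \<in> G. x \<in> B} \<noteq> {}" "{B \<in> G. x \<notin> B} \<noteq> {}"
    by blast
  then have "2 ^ Suc t \<le> card {B \<in> G. x \<in> B}" "2 ^ Suc t \<le> card {B \<in> G. x \<notin> B}"
    using Suc.IH even_upto_filter[OF Suc.prems(1)] by blast+
  moreover have "card G = card {B \<in> G. x \<in> B} + card {B \<in> G. x \<notin> B}"
    using deg_split[OF fin, of "{}" x] by (simp add: deg_def)
  ultimately show ?case by simp
qed

text \<open>Inclusion-exclusion modulo 2: the count is an alternating sum of
  \<open>deg G (A \<union> C')\<close> over \<open>C' \<subseteq> C\<close>, and all terms with
  \<open>C' \<noteq> C\<close> concern at most \<open>t\<close> points. The last one may concern
  \<open>Suc t\<close> points and be odd.\<close>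

lemma even_upto_avoid:
  assumes G: "even_upto t G" and "finite C" "finite A" "A \<inter> C = {}" "card (A \<union> C) \<le> Suc t"
  shows "even (card {B \<in> G. A \<subseteq> B \<and> C \<inter> B = {}} + deg G (A \<union> C))"
  using assms(2-)
proof (induction C arbitrary: A)
  case empty
  then show ?case by (simp add: deg_def)
next
  case (insert c C)
  have fin: "finite G" using G by (simp add: even_upto_def)
  have "{B \<in> G. A \<subseteq> B \<and> C \<inter> B = {}} =
      {B \<in> G. A \<subseteq> B \<and> insert c C \<inter> B = {}} \<union> {B \<in> G. insert c A \<subseteq> B \<and> C \<inter> B = {}}"
    by auto
  then have split: "card {B \<in> G. A \<subseteq> B \<and> C \<inter> B = {}} =
      card {B \<in> G. A \<subseteq> B \<and> insert c C \<inter> B = {}} + card {B \<in> G. insert c A \<subseteq> B \<and> C \<inter> B = {}}"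
    using fin by (simp only:, subst card_Un_disjoint) auto
  have c: "c \<notin> A \<union> C" using insert by auto
  then have le: "card (A \<union> C) \<le> t"
    using insert by auto
  have "even (card {B \<in> G. A \<subseteq> B \<and> C \<inter> B = {}} + deg G (A \<union> C))"
    using insert le by (intro insert.IH) auto
  moreover have "even (deg G (A \<union> C))"
    using insert le by (intro even_uptoD[OF G]) auto
  moreover have "even (card {B \<in> G. insert c A \<subseteq> B \<and> C \<inter> B = {}} + deg G (insert c A \<union> C))"
    using insert by (intro insert.IH) auto
  ultimately show ?case using split by simp
qed

text \<open>The indicator function of \<open>G\<close> has degree at most \<open>n - t - 1\<close> as a polynomial over the
  field with two elements; its derivative in direction \<open>H\<close> has smaller degree.\<close>

lemma even_upto_translate_sym_diff:
  assumes G: "even_upto t G"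
  shows "even_upto (Suc t) (sym_diff G ((\<lambda>B. sym_diff B H) ` G))"
proof -
  let ?s = "\<lambda>B. sym_diff B H"
  have fin: "finite G" using G by (simp add: even_upto_def)
  have inj: "inj_on ?s X" for X by (rule inj_onI) blast
  have "even (deg (sym_diff G (?s ` G)) T)" if T: "finite T" "card T \<le> Suc t" for T
  proof -
    let ?X = "{B \<in> G. T \<subseteq> B}" and ?Y = "{B \<in> ?s ` G. T \<subseteq> B}"
    \<comment> \<open>Lying in a translate means that one part of \<open>T\<close> is contained and
      the other avoided; by \<open>even_upto_avoid\<close> the count has the parity of
      \<open>deg G T\<close>.\<close>
    have "T \<subseteq> ?s B \<longleftrightarrow> T - H \<subseteq> B \<and> (T \<inter> H) \<inter> B = {}" for B by auto
    then have "?Y = ?s ` {B \<in> G. T - H \<subseteq> B \<and> (T \<inter> H) \<inter> B = {}}"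
      by auto
    then have "card ?Y = card {B \<in> G. T - H \<subseteq> B \<and> (T \<inter> H) \<inter> B = {}}"
      by (simp only: card_image[OF inj])
    moreover have "(T - H) \<union> (T \<inter> H) = T" by auto
    ultimately have "even (card ?Y + card ?X)"
      using even_upto_avoid[OF G, of "T \<inter> H" "T - H"] T by (auto simp: deg_def)
    moreover have "card ?X = card (?X - ?Y) + card (?X \<inter> ?Y)"
      using fin by (subst card_Un_disjoint[symmetric]) (auto intro!: arg_cong[where f=card])
    moreover have "card ?Y = card (?Y - ?X) + card (?X \<inter> ?Y)"
      using fin by (subst card_Un_disjoint[symmetric]) (auto intro!: arg_cong[where f=card])
    moreover have "deg (sym_diff G (?s ` G)) T = card (?X - ?Y) + card (?Y - ?X)"
      unfolding deg_def using fin
      by (subst card_Un_disjoint[symmetric]) (auto intro!: arg_cong[where f=card])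
    ultimately show ?thesis by presburger
  qed
  then show ?thesis using fin by (simp add: even_upto_def)
qed

text \<open>The derivative in direction \<open>{x, y}\<close> is empty or has at least
  \<open>2 * card G\<close> members. It has fewer, because \<open>{x}\<close>, the translate of
  \<open>{y}\<close>, lies both in \<open>G\<close> and in its translate.\<close>

lemma even_upto_card_eq_closed:
  assumes G: "even_upto t G" and card: "card G = 2 ^ Suc t"
    and xy: "{x} \<in> G" "{y} \<in> G" "x \<noteq> y" and B: "B \<in> G"
  shows "sym_diff B {x, y} \<in> G"
proof (rule ccontr)
  let ?s = "\<lambda>B. sym_diff B {x, y}"
  let ?E = "sym_diff G (?s ` G)"
  assume "?s B \<notin> G"
  then have "?E \<noteq> {}" using B by blast
  then have *: "2 ^ Suc (Suc t) \<le> card ?E"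
    by (rule even_upto_card_ge[OF even_upto_translate_sym_diff[OF G]])
  have fin: "finite G" using G by (simp add: even_upto_def)
  have "{x} \<in> ?s ` G"
    by (rule image_eqI[of _ _ "{y}"]) (use xy in auto)
  then have x: "{x} \<in> G \<inter> ?s ` G" using xy by simp
  have "card ?E \<le> card (G - ?s ` G) + card (?s ` G - G)"
    by (rule card_Un_le)
  also have "card (G - ?s ` G) < card G"
    using x fin by (intro psubset_card_mono) auto
  also have "card (?s ` G - G) \<le> card (?s ` G)"
    using fin by (intro card_mono) auto
  also have "card (?s ` G) \<le> card G"
    using fin by (rule card_image_le)
  finally show False using * card by simp
qed

section \<open>Small families with even pair degrees\<close>

lemma even_card_sym_diff:
  assumes "finite A" "finite B"
  shows "even (card (sym_diff A B)) \<longleftrightarrow> even (card A + card B)"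
proof -
  have "card A = card (A - B) + card (A \<inter> B)" "card B = card (B - A) + card (A \<inter> B)"
    using assms card_Diff_subset_Int card_Int_Diff by (metis add.commute inf_commute)+
  moreover have "card (sym_diff A B) = card (A - B) + card (B - A)"
    using assms by (intro card_Un_disjoint) auto
  ultimately show ?thesis by presburger
qed

text \<open>The odd points of \<open>F\<close> have orthonormal incidence vectors over the field with two
  elements, and the other points have isotropic vectors orthogonal to everything.\<close>

locale even_pairs =
  fixes F :: "'a set set" and S :: "'a set"
  assumes finite_F: "finite F" and finite_S: "finite S"
    and finite_block: "B \<in> F \<Longrightarrow> finite B"
    and odd_point: "odd (deg F {y}) \<longleftrightarrow> y \<in> S"
    and even_pair: "y \<noteq> z \<Longrightarrow> even (deg F {y, z})"
begin

text \<open>The support of the sum, over the field with two elements, of the incidence vectors of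
  the points of \<open>A\<close>; coordinates are the blocks.\<close>

definition combine :: "'a set \<Rightarrow> 'a set set" where
  "combine A = {B \<in> F. odd (card (A \<inter> B))}"

text \<open>The inner product of that sum with the vector of \<open>y\<close> is the sum of the
  \<open>deg F {a, y}\<close>, where only \<open>a = y\<close> can contribute an odd term.\<close>

lemma odd_combine:
  assumes "finite A"
  shows "odd (card {B \<in> combine A. y \<in> B}) \<longleftrightarrow> y \<in> A \<and> y \<in> S"
proof -
  let ?Fy = "{B \<in> F. y \<in> B}"
  have "(\<Sum>a\<in>A. deg F {a, y}) = (\<Sum>a\<in>A. card {B \<in> ?Fy. a \<in> B})"
    unfolding deg_def by (intro sum.cong refl arg_cong[where f=card]) auto
  also have "\<dots> = (\<Sum>B\<in>?Fy. card {a \<in> A. a \<in> B})"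
    using assms finite_F by (intro sum_multicount_gen) auto
  finally have "even (\<Sum>a\<in>A. deg F {a, y}) \<longleftrightarrow> even (\<Sum>B\<in>?Fy. card {a \<in> A. a \<in> B})"
    by (rule arg_cong)
  then have "even (card {a \<in> A. odd (deg F {a, y})}) \<longleftrightarrow>
      even (card {B \<in> ?Fy. odd (card {a \<in> A. a \<in> B})})"
    using even_sum_iff[OF assms, of "\<lambda>a. deg F {a, y}"]
      even_sum_iff[of ?Fy "\<lambda>B. card {a \<in> A. a \<in> B}"] finite_F by simp
  moreover have "{B \<in> ?Fy. odd (card {a \<in> A. a \<in> B})} = {B \<in> combine A. y \<in> B}"
    by (auto simp: combine_def Int_def)
  moreover have "odd (deg F {a, y}) \<longleftrightarrow> a = y \<and> y \<in> S" for a
    using odd_point[of y] even_pair[of a y] by (cases "a = y") auto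
  then have "{a \<in> A. odd (deg F {a, y})} = (if y \<in> A \<and> y \<in> S then {y} else {})"
    by auto
  ultimately show ?thesis by (auto split: if_splits)
qed

lemma inj_combine:
  assumes X: "finite X" and ne: "\<And>A. A \<subseteq> X \<Longrightarrow> A \<noteq> {} \<Longrightarrow> combine A \<noteq> {}"
  shows "inj_on combine (Pow X)"
proof (rule inj_onI)
  fix A A' assume A: "A \<in> Pow X" "A' \<in> Pow X" "combine A = combine A'"
  have fin: "finite A" "finite A'" using A X finite_subset by auto
  have "even (card (sym_diff A A' \<inter> B))" if "B \<in> F" for B
  proof -
    have "odd (card (A \<inter> B)) \<longleftrightarrow> odd (card (A' \<inter> B))"
      using that A(3) by (auto simp: combine_def)
    moreover have "sym_diff A A' \<inter> B = sym_diff (A \<inter> B) (A' \<inter> B)" by auto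
    ultimately show ?thesis
      using even_card_sym_diff[of "A \<inter> B" "A' \<inter> B"] fin by simp
  qed
  then have "combine (sym_diff A A') = {}" by (auto simp: combine_def)
  then show "A = A'" using ne[of "sym_diff A A'"] A by blast
qed

text \<open>Independent vectors have \<open>2 ^ card X\<close> distinct sums among the subsets of
  \<open>F\<close>. In case of equality each unit vector \<open>{B}\<close> is a sum, and its
  product with a point of \<open>B\<close> is 1, so that \<open>odd_combine\<close> puts the point
  in \<open>S\<close>.\<close>

lemma card_independent:
  assumes X: "finite X" and ne: "\<And>A. A \<subseteq> X \<Longrightarrow> A \<noteq> {} \<Longrightarrow> combine A \<noteq> {}"
  shows "card X \<le> card F" "card X = card F \<Longrightarrow> B \<in> F \<Longrightarrow> B \<subseteq> S"
proof -
  have sub: "combine ` Pow X \<subseteq> Pow F" by (auto simp: combine_def)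
  have card: "card (combine ` Pow X) = 2 ^ card X"
    using inj_combine[OF assms] X by (simp add: card_image card_Pow)
  then have "(2::nat) ^ card X \<le> 2 ^ card F"
    using card_mono[OF _ sub] finite_F by (simp add: card_Pow)
  then show "card X \<le> card F" by simp
  assume eq: "card X = card F" and B: "B \<in> F"
  then have "combine ` Pow X = Pow F"
    using card sub finite_F by (intro card_subset_eq) (auto simp: card_Pow)
  then have "{B} \<in> combine ` Pow X" using B by simp
  then obtain A where A: "A \<subseteq> X" "combine A = {B}" by auto
  have "u \<in> S" if "u \<in> B" for u
  proof -
    have "{B' \<in> combine A. u \<in> B'} = {B}" using A that by auto
    moreover have "finite A" using A(1) X by (rule finite_subset)
    ultimately show ?thesis using odd_combine[of A u] by simp
  qed
  then show "B \<subseteq> S" by auto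
qed

lemma combine_nonempty:
  assumes "finite A" "A \<inter> S \<noteq> {}"
  shows "combine A \<noteq> {}"
proof
  assume "combine A = {}"
  moreover obtain y where "y \<in> A" "y \<in> S" using assms(2) by auto
  ultimately show False using odd_combine[OF assms(1), of y] by simp
qed

end

text \<open>Since \<open>|F| \<le> |S| + 2\<close>, the isotropic vectors orthogonal to \<open>S\<close> span at most a line; if it
  were nonzero, every block would contain the points outside \<open>S\<close> that have this vector, which
  contradicts that the vectors of \<open>S\<close> are odd.\<close>

lemma residual_uniform:
  fixes F :: "'a set set"
  assumes F: "finite F" "card F \<le> 6" and block: "\<And>B. B \<in> F \<Longrightarrow> finite B \<and> card B = k"
    and k: "5 \<le> k" "odd k" and S: "finite S" "4 \<le> card S"
    and odd: "\<And>y. odd (deg F {y}) \<longleftrightarrow> y \<in> S"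
    and even: "\<And>y z. y \<noteq> z \<Longrightarrow> even (deg F {y, z})"
  shows "k = 5 \<and> card S = 6 \<and> F = {B. B \<subseteq> S \<and> card B = 5}"
proof -
  interpret even_pairs F S
    by unfold_locales (use F S block odd even in auto)
  have le: "card S \<le> card F"
    using S(1) by (rule card_independent(1)) (metis combine_nonempty S(1) finite_subset inf.absorb1)
  have inside: "B \<subseteq> S" if "B \<in> F" for B
  proof (rule ccontr)
    assume "\<not> B \<subseteq> S"
    then obtain u where u: "u \<in> B" "u \<notin> S" by auto
    have ne1: "combine {v} \<noteq> {}" if "v \<in> C" "C \<in> F" for v C
      using that by (auto simp: combine_def intro!: bexI[of _ C])
    have ne: "combine A \<noteq> {}" if "A \<subseteq> insert u S" "A \<noteq> {}" for A
    proof (cases "A \<inter> S = {}")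
      case True
      then have "A = {u}" using that by auto
      then show ?thesis using ne1 u \<open>B \<in> F\<close> by auto
    next
      case False
      then show ?thesis using combine_nonempty that S finite_subset by (metis finite_insert)
    qed
    have "card (insert u S) = Suc (card S)" using u S by simp
    moreover have "card (insert u S) \<le> card F"
      using S by (intro card_independent(1) ne) auto
    \<comment> \<open>Equality would make the vectors of \<open>insert u S\<close> a basis and force
      \<open>B\<close> into \<open>S\<close>.\<close>
    moreover have "card (insert u S) \<noteq> card F"
      using card_independent(2)[of "insert u S" B] ne S u \<open>B \<in> F\<close> by auto
    ultimately have "Suc (card S) \<le> card F" "Suc (card S) \<noteq> card F" by simp_all
    then have 4: "card S = 4" "card F = 6" using F S by auto
    \<comment> \<open>Points outside \<open>S\<close> that lie in some block share one vector: a
      second nonzero one would complete a basis of six vectors.\<close>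
    have all: "{C \<in> F. v \<in> C} = {C \<in> F. u \<in> C}" if v: "v \<in> B'" "B' \<in> F" "v \<notin> S" for v B'
    proof (rule ccontr)
      assume diff: "{C \<in> F. v \<in> C} \<noteq> {C \<in> F. u \<in> C}"
      then obtain C where C: "C \<in> F" "v \<in> C \<longleftrightarrow> u \<notin> C" by auto
      have "u \<noteq> v" using diff by auto
      have "combine A \<noteq> {}" if A: "A \<subseteq> {u, v} \<union> S" "A \<noteq> {}" for A
      proof (cases "A \<inter> S = {}")
        case True
        then have "A \<in> Pow {u, v}" using A by auto
        then consider "A = {u}" | "A = {v}" | "A = {u, v}" using A by (auto simp: Pow_insert)
        then show ?thesis
        proof cases
          case 3
          have "{u, v} \<inter> C = {u} \<or> {u, v} \<inter> C = {v}" using C by auto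
          then have "card (A \<inter> C) = 1" unfolding 3 by (elim disjE) (simp_all only: is_singletonI is_singleton_altdef[symmetric])
          then have "C \<in> combine A" using C(1) by (simp add: combine_def)
          then show ?thesis by auto
        qed (use ne1 u v \<open>B \<in> F\<close> in auto)
      next
        case False
        then show ?thesis
          using combine_nonempty A S finite_subset by (metis finite.emptyI finite_Un finite_insert)
      qed
      moreover have "card ({u, v} \<union> S) = card F"
        using \<open>u \<noteq> v\<close> u v S 4 by simp
      ultimately have "B \<subseteq> S"
        using card_independent(2)[of "{u, v} \<union> S" B] S \<open>B \<in> F\<close> by simp
      then show False using u by auto
    qed
    \<comment> \<open>A block has at least five points, so it leaves the 4-set \<open>S\<close> and
      contains a point with the vector of \<open>u\<close>.\<close>
    have "u \<in> B'" if B': "B' \<in> F" for B'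
    proof -
      have "\<not> B' \<subseteq> S"
        using card_mono[OF S(1), of B'] block[OF B'] k 4 by auto
      then show ?thesis using all B' by blast
    qed
    then have "deg F {u, y} = deg F {y}" for y
      unfolding deg_def by (intro arg_cong[where f=card]) auto
    moreover obtain y where "y \<in> S" using S by fastforce
    ultimately show False using odd even u by metis
  qed
  have sub: "F \<subseteq> {B. B \<subseteq> S \<and> card B = k}" using inside block by auto
  then have choose: "card F \<le> card S choose k"
    using card_mono[OF _ sub] S by (simp add: n_subsets)
  obtain B where "B \<in> F" using le S by fastforce
  then have "k \<le> card S" using inside card_mono[OF S(1)] block by metis
  moreover have "k \<noteq> 6" using k by auto
  \<comment> \<open>Here \<open>5 \<le> k \<le> card S \<le> card F \<le> 6\<close>. A 5-set has
    only one 5-subset, which excludes \<open>card S = 5\<close>.\<close>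
  ultimately have *: "k = 5" "card S = 5 \<or> card S = 6"
    using k F le by linarith+
  then have "card S = 6" using le choose by auto
  moreover have "(6::nat) choose 5 = 6" by (simp add: numeral_eq_Suc)
  ultimately have "F = {B. B \<subseteq> S \<and> card B = k}"
    using sub S F le * by (intro card_subset_eq) (auto simp: n_subsets)
  then show ?thesis using * \<open>card S = 6\<close> by simp
qed

section \<open>Degrees in designs\<close>

lemma sum_deg_supersets:
  assumes "finite N" "finite D" "\<And>B. B \<in> D \<Longrightarrow> B \<subseteq> N \<and> card B = k" "finite T"
  shows "(\<Sum>U | U \<subseteq> N - T \<and> card U = j. deg D (T \<union> U)) = (k - card T choose j) * deg D T"
proof -
  let ?U = "{U. U \<subseteq> N - T \<and> card U = j}"
  have finU: "finite ?U" using assms by auto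
  have "(\<Sum>U\<in>?U. deg D (T \<union> U)) = (\<Sum>U\<in>?U. card {B \<in> {B \<in> D. T \<subseteq> B}. U \<subseteq> B})"
    unfolding deg_def by (intro sum.cong refl arg_cong[where f=card]) auto
  also have "\<dots> = (\<Sum>B | B \<in> D \<and> T \<subseteq> B. card {U \<in> ?U. U \<subseteq> B})"
    using finU assms by (intro sum_multicount_gen) auto
  also have "\<dots> = (\<Sum>B | B \<in> D \<and> T \<subseteq> B. k - card T choose j)"
  proof (rule sum.cong[OF refl])
    fix B assume B: "B \<in> {B. B \<in> D \<and> T \<subseteq> B}"
    then have B': "T \<subseteq> B" "B \<subseteq> N" "card B = k" using assms(3) by auto
    then have "finite B" using assms(1) finite_subset by metis
    have "{U \<in> ?U. U \<subseteq> B} = {U. U \<subseteq> B - T \<and> card U = j}"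
      using B' by auto
    moreover have "card (B - T) = k - card T"
      using B' assms(4) by (simp add: card_Diff_subset)
    ultimately show "card {U \<in> ?U. U \<subseteq> B} = (k - card T choose j)"
      using n_subsets[of "B - T" j] \<open>finite B\<close> by simp
  qed
  finally show ?thesis by (simp add: deg_def)
qed

lemma deg_outside:
  assumes "\<And>B. B \<in> D \<Longrightarrow> B \<subseteq> N" "\<not> T \<subseteq> N"
  shows "deg D T = 0"
proof -
  have "{B \<in> D. T \<subseteq> B} = {}" using assms by blast
  then show ?thesis by (simp only: deg_def card.empty)
qed

text \<open>Summing the even degrees of all \<open>t\<close>-sets above \<open>T\<close> gives a
  binomial coefficient times \<open>deg D T\<close>; an odd coefficient can be cancelled modulo
  2.\<close>

lemma even_deg_lower:
  assumes "finite N" "finite D" and D: "\<And>B. B \<in> D \<Longrightarrow> B \<subseteq> N \<and> card B = k"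
    and even: "\<And>T. T \<subseteq> N \<Longrightarrow> card T = t \<Longrightarrow> even (deg D T)"
    and T: "finite T" "card T \<le> t" "odd (k - card T choose (t - card T))"
  shows "even (deg D T)"
proof (cases "T \<subseteq> N")
  case True
  have "even (deg D (T \<union> U))" if U: "U \<subseteq> N - T" "card U = t - card T" for U
  proof (rule even)
    have "finite U" "T \<inter> U = {}" using U assms(1) finite_subset by blast+
    then show "card (T \<union> U) = t" using U T by (simp add: card_Un_disjoint)
  qed (use U True in auto)
  then have "even (\<Sum>U | U \<subseteq> N - T \<and> card U = t - card T. deg D (T \<union> U))"
    by (intro dvd_sum) auto
  then show ?thesis
    using T sum_deg_supersets[OF assms(1,2) D T(1), of "t - card T"] by auto
next
  case False
  then show ?thesis using deg_outside[of D N T] D by auto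
qed

section \<open>Lower bounds for 3-designs with odd block size\<close>

locale odd_three_design =
  fixes N :: "'a set" and k :: nat and D :: "'a set set"
  assumes finite_N: "finite N" and k: "5 \<le> k" "odd k" and design: "binary_design 3 N k D"
begin

lemma block: "B \<in> D \<Longrightarrow> B \<subseteq> N \<and> card B = k"
  using design by (simp add: binary_design_def)

lemma finite_D: "finite D"
  using block finite_N by (meson PowI finite_Pow_iff finite_subset subsetI)

lemma even_three: "finite T \<Longrightarrow> card T = 3 \<Longrightarrow> even (deg D T)"
  using even_deg_lower[OF finite_N finite_D block, of 3 T] design
  by (simp add: binary_design_def deg_def)

lemma even_two: "finite T \<Longrightarrow> card T = 2 \<Longrightarrow> even (deg D T)"
  using even_deg_lower[OF finite_N finite_D block, of 3 T] k even_three
    finite_subset[OF _ finite_N] by auto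

text \<open>The point degrees sum to \<open>k * card D\<close>, and \<open>k\<close> is odd.\<close>

lemma parity_card: "even (card D + card {x. odd (deg D {x})})"
proof -
  have sub: "{x. odd (deg D {x})} \<subseteq> N"
    using deg_outside[of D N] block by fastforce
  have "{U. U \<subseteq> N \<and> card U = 1} = (\<lambda>x. {x}) ` N"
    by (auto simp: card_1_singleton_iff)
  then have "(\<Sum>U | U \<subseteq> N \<and> card U = 1. deg D U) = (\<Sum>x\<in>N. deg D {x})"
    by (simp add: sum.reindex)
  then have "(\<Sum>x\<in>N. deg D {x}) = k * card D"
    using sum_deg_supersets[OF finite_N finite_D block, of "{}" 1] by simp
  moreover have "even (\<Sum>x\<in>N. deg D {x}) \<longleftrightarrow> even (card {x \<in> N. odd (deg D {x})})"
    using finite_N by (rule even_sum_iff)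
  moreover have "{x \<in> N. odd (deg D {x})} = {x. odd (deg D {x})}"
    using sub by auto
  ultimately show ?thesis using k by auto
qed

lemma finite_odd: "finite {x. odd (deg D {x})}"
  using deg_outside[of D N] block finite_N
  by (rule_tac finite_subset[of _ N]) fastforce+

lemma card_ge_16:
  assumes "k mod 4 = 3"
  shows "16 \<le> card D"
proof -
  obtain q where q: "k = 4 * q + 3" using assms by (metis mult_div_mod_eq)
  \<comment> \<open>This is the coefficient that \<open>even_deg_lower\<close> needs in order to
    pass from triples to single points.\<close>
  have "k - 1 choose 2 = (2 * q + 1) * (4 * q + 1)"
    unfolding choose_two q by simp
  then have "odd (k - 1 choose 2)" by simp
  then have one: "even (deg D {x})" for x
    using even_deg_lower[OF finite_N finite_D block, of 3 "{x}"] even_three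
      finite_subset[OF _ finite_N] by auto
  have "even (deg D T)" if "finite T" "card T \<le> 3" for T
  proof -
    have "card T = 0 \<or> card T = 1 \<or> card T = 2 \<or> card T = 3"
      using that by linarith
    then consider "T = {}" | x where "T = {x}" | "card T = 2" | "card T = 3"
      using \<open>finite T\<close> by (auto simp: card_1_singleton_iff)
    then show ?thesis
      using that(1) one even_two even_three parity_card by cases simp_all
  qed
  then have "even_upto 3 D" using finite_D by (simp add: even_upto_def)
  then show ?thesis
    using even_upto_card_ge[of 3 D] design by (simp add: binary_design_def)
qed

lemma card_ge_14:
  assumes "k mod 4 = 1"
  shows "14 \<le> card D"
proof (rule ccontr)
  assume "\<not> 14 \<le> card D"
  then have m: "card D \<le> 13" by simp
  define S where "S = {x. odd (deg D {x})}"
  \<comment> \<open>The added singletons correct the odd point degrees and leave pairs and triples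
    untouched; \<open>parity_card\<close> handles the empty set.\<close>
  define G where "G = D \<union> (\<lambda>x. {x}) ` S"
  have finS: "finite S" using finite_odd by (simp add: S_def)
  have notin: "{x} \<notin> D" for x using block[of "{x}"] k by auto
  have cardG: "card G = card D + card S"
    unfolding G_def using finS finite_D notin
    by (subst card_Un_disjoint) (auto simp: card_image)
  have degG: "deg G T = deg D T + card {x \<in> S. T \<subseteq> {x}}" for T
  proof -
    have "{B \<in> G. T \<subseteq> B} = {B \<in> D. T \<subseteq> B} \<union> (\<lambda>x. {x}) ` {x \<in> S. T \<subseteq> {x}}"
      by (auto simp: G_def)
    moreover have "card \<dots> = deg D T + card {x \<in> S. T \<subseteq> {x}}"
      unfolding deg_def using finS finite_D notin
      by (subst card_Un_disjoint) (auto simp: card_image)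
    ultimately show ?thesis by (simp add: deg_def)
  qed
  have "even (deg G T)" if T: "finite T" "card T \<le> 3" for T
  proof -
    have "card T = 0 \<or> card T = 1 \<or> card T = 2 \<or> card T = 3"
      using T(2) by linarith
    then consider "T = {}" | y where "T = {y}" | "card T = 2 \<or> card T = 3"
      using \<open>finite T\<close> by (auto simp: card_1_singleton_iff)
    then show ?thesis
    proof cases
      case 1
      then show ?thesis using parity_card cardG by (simp add: S_def)
    next
      case (2 y)
      then have "{x \<in> S. T \<subseteq> {x}} = (if y \<in> S then {y} else {})" by auto
      then show ?thesis using 2 by (simp add: degG S_def)
    next
      case 3
      then have none: "{x \<in> S. T \<subseteq> {x}} = {}"
        using card_mono[of "{_}" T] by fastforce
      then show ?thesis using 3 T even_two[of T] even_three[of T] unfolding degG none by auto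
    qed
  qed
  then have G: "even_upto 3 G"
    using finite_D finS by (simp add: even_upto_def G_def)
  have "G \<noteq> {}" using design by (auto simp: binary_design_def G_def)
  then have ge: "16 \<le> card G" using even_upto_card_ge[OF G] by simp
  have "card G \<noteq> 16"
  proof
    assume 16: "card G = 16"
    then have "3 \<le> card S" using cardG m by simp
    then obtain X where X: "X \<subseteq> S" "card X = 3" using obtain_subset_with_card_n by metis
    then obtain x y z where xyz: "X = {x, y, z}" "x \<noteq> y" "x \<noteq> z" "y \<noteq> z"
      by (auto simp: card_3_iff)
    \<comment> \<open>Translating a singleton yields a 3-set, which is neither a singleton nor a
      block, as \<open>k \<ge> 5\<close>.\<close>
    then have "sym_diff {z} {x, y} \<in> G"
      using X 16 by (intro even_upto_card_eq_closed[OF G]) (auto simp: G_def)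
    moreover have "sym_diff {z} {x, y} = X" using xyz by auto
    ultimately have "X \<in> G" by simp
    then show False using block[of X] X k by (auto simp: G_def)
  qed
  moreover have "even (card G)" using cardG parity_card by (simp add: S_def)
  ultimately have "18 \<le> card G" using ge by presburger
  then have r: "5 \<le> card S" using cardG m by simp
  have avoid: "k = 5 \<and> card (S - {x}) = 6 \<and>
      {B \<in> D. x \<notin> B} = {B. B \<subseteq> S - {x} \<and> card B = 5}" if x: "x \<in> S" for x
  proof (rule residual_uniform)
    let ?F = "{B \<in> D. x \<notin> B}"
    \<comment> \<open>The members of \<open>G\<close> through \<open>x\<close> number at least 8.
      One of them is \<open>{x}\<close>, so at least 7 of at most 13 blocks contain
      \<open>x\<close>.\<close>
    have "{B \<in> G. x \<in> B} = insert {x} {B \<in> D. x \<in> B}"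
      using x by (auto simp: G_def)
    then have "card {B \<in> G. x \<in> B} = Suc (deg D {x})"
      using finite_D notin by (simp add: deg_def)
    moreover have "even_upto 2 {B \<in> G. x \<in> B}"
      using even_upto_filter(1)[of 2 G x] G by (simp add: numeral_3_eq_3 numeral_2_eq_2)
    ultimately have "8 \<le> Suc (deg D {x})"
      using even_upto_card_ge[of 2 "{B \<in> G. x \<in> B}"] \<open>{B \<in> G. x \<in> B} = _\<close> by force
    then show "card ?F \<le> 6"
      using deg_split[OF finite_D, of "{}" x] m by simp
    show "finite ?F" using finite_D by simp
    show "finite B \<and> card B = k" if "B \<in> ?F" for B
      using that block[of B] finite_subset[OF _ finite_N] by auto
    show "4 \<le> card (S - {x})" using r x finS by simp
    show "finite (S - {x})" using finS by simp
    have split: "deg D T = deg D (insert x T) + deg ?F T" for T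
      by (rule deg_split[OF finite_D])
    have zero: "deg ?F T = 0" if "x \<in> T" for T
      using split[of T] that by (simp add: insert_absorb)
    \<comment> \<open>Sets enlarged by \<open>x\<close> have even degree, so discarding the blocks
      through \<open>x\<close> preserves parities away from \<open>x\<close>.\<close>
    show "odd (deg ?F {y}) \<longleftrightarrow> y \<in> S - {x}" for y
    proof (cases "y = x")
      case False
      then have "even (deg D {x, y})" by (intro even_two) auto
      then have "odd (deg ?F {y}) \<longleftrightarrow> odd (deg D {y})" using split[of "{y}"] by simp
      then show ?thesis using False by (simp add: S_def)
    qed (simp add: zero)
    show "even (deg ?F {y, z})" if "y \<noteq> z" for y z
    proof (cases "x \<in> {y, z}")
      case False
      then have "even (deg D {x, y, z})" "even (deg D {y, z})"
        using that by (intro even_two even_three; simp)+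
      then show ?thesis using split[of "{y, z}"] by simp
    qed (simp add: zero)
  qed (use k in auto)
  have "S \<noteq> {}" using r by auto
  then obtain x where "x \<in> S" by auto
  then have "card (S - {x}) = 6" using avoid by blast
  then have S7: "card S = 7" using card.remove[OF finS \<open>x \<in> S\<close>] by linarith
  \<comment> \<open>Each 5-subset of the 7-set \<open>S\<close> misses some \<open>x \<in> S\<close>
    and is thus a block avoiding \<open>x\<close>.\<close>
  have "{B. B \<subseteq> S \<and> card B = 5} \<subseteq> D"
  proof
    fix B assume B: "B \<in> {B. B \<subseteq> S \<and> card B = 5}"
    then have "B \<noteq> S" using S7 by auto
    then obtain x where "x \<in> S" "x \<notin> B" using B by auto
    then show "B \<in> D" using avoid[of x] B by blast
  qed
  then have "card {B. B \<subseteq> S \<and> card B = 5} \<le> card D"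
    using finite_D by (rule card_mono[rotated])
  moreover have "(7::nat) choose 5 = 21" by (simp add: numeral_eq_Suc)
  ultimately show False using n_subsets[OF finS, of 5] S7 m by simp
qed

end

section \<open>Constructions\<close>

lemma binary_design_image:
  assumes "inj_on b I" "I \<noteq> {}" "\<And>i. i \<in> I \<Longrightarrow> b i \<subseteq> N \<and> card (b i) = k"
    and even: "\<And>T. T \<subseteq> N \<Longrightarrow> card T = t \<Longrightarrow> even (card {i \<in> I. T \<subseteq> b i})"
  shows "binary_design t N k (b ` I)"
proof -
  have "card {B \<in> b ` I. T \<subseteq> B} = card {i \<in> I. T \<subseteq> b i}" for T
  proof -
    have "{B \<in> b ` I. T \<subseteq> B} = b ` {i \<in> I. T \<subseteq> b i}" by auto
    moreover have "inj_on b {i \<in> I. T \<subseteq> b i}" using assms(1) by (rule inj_on_subset) auto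
    ultimately show ?thesis by (simp add: card_image)
  qed
  then show ?thesis using assms by (auto simp: binary_design_def)
qed

text \<open>The involution exchanges the elements satisfying \<open>P\<close> with the
  others.\<close>

lemma even_card_involution:
  assumes "finite X" "\<And>x. x \<in> X \<Longrightarrow> f x \<in> X \<and> f (f x) = x \<and> (P (f x) \<longleftrightarrow> \<not> P x)"
  shows "even (card X)"
proof -
  have "bij_betw f {x \<in> X. P x} {x \<in> X. \<not> P x}"
    by (rule bij_betw_byWitness[where f'=f]) (use assms(2) in auto)
  then have "card {x \<in> X. P x} = card {x \<in> X. \<not> P x}" by (rule bij_betw_same_card)
  moreover have "card X = card {x \<in> X. P x} + card {x \<in> X. \<not> P x}"
    using assms(1) by (subst card_Un_disjoint[symmetric]) (auto intro!: arg_cong[where f=card])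
  ultimately show ?thesis by simp
qed

text \<open>The blocks are the transversals of four disjoint pairs, enlarged by \<open>k - 4\<close> fixed points.\<close>

lemma ex_design_16:
  fixes n k :: nat
  assumes k: "4 \<le> k" and n: "k + 4 \<le> n"
  shows "\<exists>D. binary_design 3 {..<n} k D \<and> card D = 16"
proof -
  \<comment> \<open>The pairs are \<open>{2 * i, 2 * i + 1}\<close> for \<open>i < 4\<close>, and
    \<open>A\<close> tells where the even element is chosen.\<close>
  define b :: "nat set \<Rightarrow> nat set"
    where "b A = (\<lambda>i. if i \<in> A then 2 * i else 2 * i + 1) ` {..<4} \<union> {8..<k + 4}" for A
  have mem: "2 * i \<in> b A \<longleftrightarrow> i \<in> A" if "i < 4" for i A
    using that by (auto simp: b_def) presburger+
  have inj: "inj_on b (Pow {..<4})"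
  proof (rule inj_onI)
    fix A A' assume A: "A \<in> Pow {..<4}" "A' \<in> Pow {..<4}" "b A = b A'"
    then have "i \<in> A \<longleftrightarrow> i \<in> A'" if "i < 4" for i using mem[OF that] by metis
    then show "A = A'" using A by auto
  qed
  have "binary_design 3 {..<n} k (b ` Pow {..<4})"
  proof (rule binary_design_image[OF inj])
    fix A :: "nat set"
    let ?g = "\<lambda>i. if i \<in> A then 2 * i else 2 * i + 1"
    have "inj_on ?g {..<4}" by (rule inj_on_inverseI[where g = "\<lambda>m. m div 2"]) auto
    then have "card (?g ` {..<4}) = 4" by (simp only: card_image card_lessThan)
    moreover have lt: "?g ` {..<4} \<subseteq> {..<8}" by auto
    moreover have "{..<8} \<inter> {8..<k + 4} = {}" by auto
    ultimately have "card (b A) = 4 + card {8..<k + 4}"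
      unfolding b_def
      by (subst card_Un_disjoint)
          (simp only: finite_imageI finite_lessThan finite_atLeastLessThan | blast)+
    then have "card (b A) = k" using k by simp
    moreover have "{..<8} \<union> {8..<k + 4} \<subseteq> {..<n}" using k n by auto
    then have "b A \<subseteq> {..<n}" using lt unfolding b_def by blast
    ultimately show "b A \<subseteq> {..<n} \<and> card (b A) = k" by simp
  next
    fix T assume T: "T \<subseteq> {..<n}" "card T = 3"
    then have finT: "finite T" using finite_subset by blast
    \<comment> \<open>Three points cannot meet four disjoint pairs; switching the choice in an unmet
      pair pairs up the blocks containing \<open>T\<close>.\<close>
    have "\<exists>i<4. 2 * i \<notin> T \<and> 2 * i + 1 \<notin> T"
    proof (rule ccontr)
      assume "\<not> ?thesis"
      then have hit: "2 * i \<in> T \<or> 2 * i + 1 \<in> T" if "i < 4" for i using that by auto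
      have "i \<in> (\<lambda>p. p div 2) ` T" if "i < 4" for i
        using hit[OF that] by (elim disjE; intro image_eqI[of i]) auto
      then have "{..<4} \<subseteq> (\<lambda>p. p div 2) ` T" by auto
      then have "4 \<le> card ((\<lambda>p. p div 2) ` T)"
        using card_mono[of "(\<lambda>p. p div 2) ` T" "{..<4}"] finT by simp
      also have "\<dots> \<le> card T" using finT by (rule card_image_le)
      finally show False using T by simp
    qed
    then obtain i where i: "i < 4" "2 * i \<notin> T" "2 * i + 1 \<notin> T" by auto
    have "T \<subseteq> b (sym_diff A {i})" if "T \<subseteq> b A" for A
    proof
      fix p assume p: "p \<in> T"
      then have "p \<noteq> 2 * i" "p \<noteq> 2 * i + 1" "p \<in> b A" using i that by auto
      then show "p \<in> b (sym_diff A {i})"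
        unfolding b_def by (auto simp: image_iff split: if_splits)
    qed
    then show "even (card {A \<in> Pow {..<4}. T \<subseteq> b A})"
      using i(1)
      by (intro even_card_involution[where f = "\<lambda>A. sym_diff A {i}" and P = "\<lambda>A. i \<in> A"]) auto
  qed auto
  moreover have "card (b ` Pow {..<4}) = 16" using inj by (simp add: card_image card_Pow)
  ultimately show ?thesis by blast
qed

text \<open>The complement of the translate by \<open>j\<close> of the line \<open>{0, 1, 3}\<close> in the Fano plane
  on the residues modulo 7.\<close>

definition fano_co :: "nat \<Rightarrow> nat set" where
  "fano_co j = {(2 + j) mod 7, (4 + j) mod 7, (5 + j) mod 7, (6 + j) mod 7}"

lemma less_7_cases: "j < 7 \<longleftrightarrow> j = 0 \<or> j = 1 \<or> j = 2 \<or> j = 3 \<or> j = 4 \<or> j = 5 \<or> j = (6::nat)"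
  by auto

lemma fano_co_simps:
  "fano_co 0 = {2, 4, 5, 6}" "fano_co 1 = {3, 5, 6, 0}" "fano_co 2 = {4, 6, 0, 1}"
  "fano_co 3 = {5, 0, 1, 2}" "fano_co 4 = {6, 1, 2, 3}" "fano_co 5 = {0, 2, 3, 4}"
  "fano_co 6 = {1, 3, 4, 5}"
  by (auto simp: fano_co_def)

text \<open>Line complements form a 2-(7,4,2) design with point degree 4. The case
  \<open>a = c\<close> matters, since two points may replace the same Fano point.\<close>

lemma even_card_fano_co:
  assumes "a < 7" "c < 7"
  shows "even (card {j \<in> {..<7}. a \<in> fano_co j \<and> c \<in> fano_co j})"
proof -
  have "{..<7} = {0, 1, 2, 3, 4, 5, 6::nat}" by auto
  then have "card {j \<in> {..<7}. a \<in> fano_co j \<and> c \<in> fano_co j} =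
      (\<Sum>j\<in>{0, 1, 2, 3, 4, 5, 6}. of_bool (a \<in> fano_co j \<and> c \<in> fano_co j))"
    by (simp add: sum_of_bool_eq Int_def)
  then show ?thesis
    using assms unfolding less_7_cases
    by (elim disjE; simp add: fano_co_simps del: One_nat_def)
qed

lemma fano_co_subset: "fano_co j \<subseteq> {..<7}"
  by (auto simp: fano_co_def)

lemma card_fano_co: "j < 7 \<Longrightarrow> card (fano_co j) = 4"
  unfolding less_7_cases by (auto simp: fano_co_simps simp del: One_nat_def)

lemma fano_co_inj: "inj_on fano_co {..<7}"
proof (rule inj_onI)
  fix i j assume "i \<in> {..<7}" "j \<in> {..<7}" "fano_co i = fano_co j"
  then show "i = j"
    unfolding lessThan_iff less_7_cases
    by (elim disjE; simp add: fano_co_simps set_eq_subset del: One_nat_def)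
qed

text \<open>Each point of the Fano plane is replaced by \<open>s\<close> points, and each complement of a line
  is completed by one of two extra points.\<close>

lemma ex_design_14:
  fixes n s :: nat
  assumes s: "1 \<le> s" and n: "7 * s + 2 \<le> n"
  shows "\<exists>D. binary_design 3 {..<n} (4 * s + 1) D \<and> card D = 14"
proof -
  \<comment> \<open>Residue classes modulo 7 below \<open>7 * s\<close> are the enlarged Fano
    points; \<open>7 * s\<close> and \<open>7 * s + 1\<close> are the extra points.\<close>
  define C where "C j = {p. p < 7 * s \<and> p mod 7 \<in> fano_co j}" for j
  define b where "b = (\<lambda>(j, e). insert (7 * s + e) (C j))"
  let ?I = "{..<7::nat} \<times> {..<2::nat}"
  have cardC: "card (C j) = 4 * s" if "j < 7" for j
  proof -
    have "C j = (\<lambda>(r, i). r + 7 * i) ` (fano_co j \<times> {..<s})"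
    proof
      show "C j \<subseteq> (\<lambda>(r, i). r + 7 * i) ` (fano_co j \<times> {..<s})"
      proof
        fix p assume "p \<in> C j"
        then show "p \<in> (\<lambda>(r, i). r + 7 * i) ` (fano_co j \<times> {..<s})"
          by (intro image_eqI[of _ _ "(p mod 7, p div 7)"]) (auto simp: C_def)
      qed
      show "(\<lambda>(r, i). r + 7 * i) ` (fano_co j \<times> {..<s}) \<subseteq> C j"
        using fano_co_subset[of j] by (force simp: C_def)
    qed
    moreover have "inj_on (\<lambda>(r, i). r + 7 * i) (fano_co j \<times> {..<s})"
      by (rule inj_on_inverseI[where g = "\<lambda>p. (p mod 7, p div 7)"])
        (use fano_co_subset[of j] in auto)
    ultimately show ?thesis using card_fano_co[OF that] by (simp add: card_image card_cartesian_product)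
  qed
  have top: "7 * s + e \<notin> C j" for e j by (simp add: C_def)
  have finC: "finite (C j)" for j by (simp add: C_def)
  have inj: "inj_on b ?I"
  proof (rule inj_onI)
    fix i i' assume "i \<in> ?I" "i' \<in> ?I" "b i = b i'"
    then obtain j e j' e' where *: "j \<in> {..<7}" "j' \<in> {..<7}" "b (j, e) = b (j', e')"
      and i: "i = (j, e)" "i' = (j', e')" by blast
    then have eq: "insert (7 * s + e) (C j) = insert (7 * s + e') (C j')" by (simp add: b_def)
    then have "7 * s + e \<in> insert (7 * s + e') (C j')" by blast
    then have "e = e'" using top by auto
    then have "C j = C j'" using eq top by (metis insert_ident)
    \<comment> \<open>Since \<open>s \<ge> 1\<close>, the numbers below 7 contain one representative
      of each class.\<close>
    moreover have "fano_co i = C i \<inter> {..<7}" for i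
      using s fano_co_subset[of i] by (auto simp: C_def)
    ultimately have "fano_co j = fano_co j'" by simp
    then show "i = i'" using inj_onD[OF fano_co_inj] * i \<open>e = e'\<close> by blast
  qed
  have "binary_design 3 {..<n} (4 * s + 1) (b ` ?I)"
  proof (rule binary_design_image[OF inj])
    fix i assume "i \<in> ?I"
    then obtain j e where i: "i = (j, e)" "j < 7" "e < 2" by auto
    have "b i \<subseteq> {..<n}" using i n by (auto simp: b_def C_def)
    then show "b i \<subseteq> {..<n} \<and> card (b i) = 4 * s + 1"
      using i top finC cardC by (simp add: b_def)
  next
    fix T :: "nat set" assume T: "T \<subseteq> {..<n}" "card T = 3"
    show "even (card {i \<in> ?I. T \<subseteq> b i})"
    proof (cases "T \<subseteq> {..<7 * s}")
      case True
      \<comment> \<open>Without an extra point in \<open>T\<close>, both completions of a line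
        complement count equally.\<close>
      then have "T \<subseteq> b (j, e) \<longleftrightarrow> T \<subseteq> C j" for j e
        unfolding b_def by fastforce
      then have "{i \<in> ?I. T \<subseteq> b i} = {j \<in> {..<7}. T \<subseteq> C j} \<times> {..<2}"
        by (simp add: set_eq_iff) blast
      then show ?thesis by (simp add: card_cartesian_product)
    next
      case False
      then obtain t where t: "t \<in> T" "7 * s \<le> t" by fastforce
      have "card (T - {t}) = 2" using T t by simp
      then obtain p q where pq: "T - {t} = {p, q}" "p \<noteq> q" by (auto simp: card_2_iff)
      then have T': "T = {t, p, q}" "p \<noteq> t" "q \<noteq> t" using t by blast+
      have sub: "T \<subseteq> b (j, e) \<longleftrightarrow> t = 7 * s + e \<and> p \<in> C j \<and> q \<in> C j" for j e
        using t T' by (auto simp: b_def C_def)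
      show ?thesis
      proof (cases "t < 7 * s + 2 \<and> p < 7 * s \<and> q < 7 * s")
        case True
        have "{i \<in> ?I. T \<subseteq> b i} =
            {j \<in> {..<7}. p mod 7 \<in> fano_co j \<and> q mod 7 \<in> fano_co j} \<times> {t - 7 * s}"
          using True t by (simp add: set_eq_iff sub C_def) auto
        then show ?thesis using even_card_fano_co[of "p mod 7" "q mod 7"]
          by (simp add: card_cartesian_product)
      next
        case False
        \<comment> \<open>No block contains two extra points or a point beyond them.\<close>
        then have "{i \<in> ?I. T \<subseteq> b i} = {}" by (auto simp: sub C_def)
        then show ?thesis by (simp only: card.empty even_zero)
      qed
    qed
  qed (auto simp: lessThan_empty_iff)
  moreover have "card (b ` ?I) = 14" using inj by (simp add: card_image card_cartesian_product)
  ultimately show ?thesis by blast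
qed

lemma min_blocks_eqI:
  assumes "\<exists>D. binary_design t {..<n} k D \<and> card D = m"
    and "\<And>D. binary_design t {..<n} k D \<Longrightarrow> m \<le> card D"
  shows "min_blocks t n k = m"
  unfolding min_blocks_def by (rule cInf_eq_minimum) (use assms in auto)

theorem theorem5:
  fixes n k :: nat
  assumes "5 \<le> k" and "odd k"
  shows "(k mod 4 = 1 \<and> real n \<ge> max (real k + 4) ((7 * real k + 1) / 4)
            \<longrightarrow> min_blocks 3 n k = 14)
       \<and> (k mod 4 = 3 \<and> n \<ge> k + 4 \<longrightarrow> min_blocks 3 n k = 16)"
proof (intro conjI impI; elim conjE)
  have design: "odd_three_design {..<n} k D" if "binary_design 3 {..<n} k D" for D
    using that assms by unfold_locales auto
  show "min_blocks 3 n k = 14"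
    if k: "k mod 4 = 1" and n: "real n \<ge> max (real k + 4) ((7 * real k + 1) / 4)"
  proof (rule min_blocks_eqI)
    obtain s where s: "k = 4 * s + 1" using k by (metis mult_div_mod_eq)
    \<comment> \<open>For \<open>k = 4 * s + 1\<close> the bound (7k + 1)/4 equals
      \<open>7 * s + 2\<close>.\<close>
    have "real (7 * s + 2) \<le> real n" using n s by (simp add: field_simps)
    then have "7 * s + 2 \<le> n" by (simp only: of_nat_le_iff)
    moreover have "1 \<le> s" using s assms by simp
    ultimately show "\<exists>D. binary_design 3 {..<n} k D \<and> card D = 14"
      using ex_design_14 s by simp
  qed (use k design odd_three_design.card_ge_14 in blast)
  show "min_blocks 3 n k = 16" if k: "k mod 4 = 3" and n: "n \<ge> k + 4"
  proof (rule min_blocks_eqI)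
    show "\<exists>D. binary_design 3 {..<n} k D \<and> card D = 16"
      using n assms by (intro ex_design_16) auto
  qed (use k design odd_three_design.card_ge_16 in blast)
qed

end
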